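(* Let $(\mathcal{A},\otimes,I)$ be a locally small, monoidally well-pointed $\dagger$-symmetric monoidal category with finite $\dagger$-biproducts, and let $(X,\mu)$ be an $H^*$-algebra in $\mathcal{A}$. For each point $x:I\to X$ put $R_x=\mu\circ(x\otimes\mathrm{id}_X)\circ\lambda_X^{-1}:X\to X$, where $\lambda_X:I\otimes X\to X$ is the left unitor, and let $R(\mu)=\{R_x \mid x:I\to X\}\subseteq \mathrm{Hom}(X,X)$. Then the commutant $R(\mu)'$ is a maximal commutative von Neumann $S^*$-semialgebra in $\mathrm{Hom}(X,X)$. Moreover, if $(X,\mu)$ satisfies the unit axiom (U), then $R(\mu)=R(\mu)'$.
   Context: A $\dagger$-category is a category with an identity-on-objects functor $\dagger:\mathcal{A}^{op}\to\mathcal{A}$ with $\dagger\circ\dagger=\mathrm{id}$. A $\dagger$-symmetric monoidal category is a symmetric monoidal category that is a $\dagger$-category, with $\dagger$ strict monoidal and all structure isomorphisms unitary ($\phi^{-1}=\phi^\dagger$). It is monoidally well-pointed if for $f,g:X\otimes Y\to Z$, $f\circ(x\otimes y)=g\circ(x\otimes y)$ for all $x:I\to X$, $y:I\to Y$ implies $f=g$. Finite $\dagger$-biproducts: a zero object and binary biproducts whose coprojections $\kappa_i$ and projections $\pi_i$ satisfy $\kappa_i^\dagger=\pi_i$. Each hom-set carries a commutative monoid structure $f+g=\nabla\circ(f\oplus g)\circ\Delta$ with unit the zero morphism. Then $S=\mathrm{Hom}(I,I)$ is a commutative $*$-semiring (addition $+$, multiplication composition, involution $\dagger$), and $\mathrm{Hom}(X,X)$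 is an $S^*$-semialgebra: a semiring under $+$ and composition, with involution $\dagger$, and scalar multiplication $s\bullet f = X\cong X\otimes I\xrightarrow{f\otimes s}X\otimes I\cong X$, satisfying $s\bullet(m\circ n)=(s\bullet m)\circ n=m\circ(s\bullet n)$ and $(s\bullet m)^\dagger=s^\dagger\bullet m^\dagger$. For $B\subseteq\mathrm{Hom}(X,X)$, the commutant is $B'=\{f:X\to X\mid f\circ g=g\circ f\ \forall g\in B\}$. A commutative von Neumann $S^*$-semialgebra is a commutative unital $S^*$-subsemialgebra $\mathbf{A}$ of $\mathrm{Hom}(X,X)$ (a subset containing $0$ and $\mathrm{id}_X$ closed under $+$, composition, scalar multiplication and $\dagger$) with $\mathbf{A}=\mathbf{A}''$; it is maximal if it is not properly contained in any other commutative subsemialgebra (equivalently $\mathbf{A}=\mathbf{A}'$). An $H^*$-algebra (called a commutative $H^*$-algebra in the paper) is an object $X$ with $\mu:X\otimes X\to X$ such that: (A) $\mu\circ(\mu\otimes\mathrm{id})=\mu\circ(\mathrm{id}\otimes\mu)\circ a$ with $a$ the associator; (C) $\mu\circ\sigma_{X,X}=\mu$ with $\sigma$ the symmetry; (S) $\mu\circ\mu^\dagger=\mathrm{id}_X$; (H) for each point $x:I\to X$ there is a copoint $\tilde{x}:X\to I$ such that $\mu\circ(x\otimes\mathrm{id}_X)\circ\lambda_X^{-1}=r_X\circ(\mathrm{id}_X\otimes\tilde{x})\circ\mu^\dagger$, with $r_X:X\otimes I\to X$ the right unitor (so in particular $R(\mu)$ is closed under $\dagger$). Axiom (U): there exists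 $\eta:I\to X$ with $\mu\circ(\eta\otimes\mathrm{id})\circ\lambda_X^{-1}=\mathrm{id}_X=\mu\circ(\mathrm{id}\otimes\eta)\circ r_X^{-1}$. *)

theory Defs
  imports Main
begin

section \<open>Dagger categories\<close>

record ('o, 'm) cat =
  Ob :: "'o set"
  Arr :: "'m set"
  Dom :: "'m \<Rightarrow> 'o"
  Cod :: "'m \<Rightarrow> 'o"
  ident :: "'o \<Rightarrow> 'm"  ("\<one>\<index>")
  compose :: "'m \<Rightarrow> 'm \<Rightarrow> 'm"  (infixr "\<cdot>\<index>" 60)

definition hom :: "('o, 'm, 'r) cat_scheme \<Rightarrow> 'o \<Rightarrow> 'o \<Rightarrow> 'm set"
  where "hom C X Y = {f \<in> Arr C. Dom C f = X \<and> Cod C f = Y}"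

text \<open>The collections of objects and of arrows are sets over arbitrary types, so every category
  below is locally small.\<close>

locale category =
  fixes C :: "('o, 'm, 'r) cat_scheme" (structure)
  assumes dom_closed: "f \<in> Arr C \<Longrightarrow> Dom C f \<in> Ob C"
    and cod_closed: "f \<in> Arr C \<Longrightarrow> Cod C f \<in> Ob C"
    and ident_closed: "X \<in> Ob C \<Longrightarrow> \<one> X \<in> hom C X X"
    and compose_closed: "\<lbrakk>g \<in> hom C Y Z; f \<in> hom C X Y\<rbrakk> \<Longrightarrow> g \<cdot> f \<in> hom C X Z"
    and compose_assoc: "\<lbrakk>h \<in> hom C Y Z; g \<in> hom C X Y; f \<in> hom C W X\<rbrakk>
          \<Longrightarrow> (h \<cdot> g) \<cdot> f = h \<cdot> (g \<cdot> f)"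
    and ident_left: "f \<in> hom C X Y \<Longrightarrow> \<one> Y \<cdot> f = f"
    and ident_right: "f \<in> hom C X Y \<Longrightarrow> f \<cdot> \<one> X = f"

definition is_inverse :: "('o, 'm, 'r) cat_scheme \<Rightarrow> 'm \<Rightarrow> 'm \<Rightarrow> bool"
  where "is_inverse C f g \<longleftrightarrow> f \<in> Arr C \<and> g \<in> hom C (Cod C f) (Dom C f) \<and>
    g \<cdot>\<^bsub>C\<^esub> f = \<one>\<^bsub>C\<^esub> (Dom C f) \<and> f \<cdot>\<^bsub>C\<^esub> g = \<one>\<^bsub>C\<^esub> (Cod C f)"

definition iso :: "('o, 'm, 'r) cat_scheme \<Rightarrow> 'm \<Rightarrow> bool"
  where "iso C f \<longleftrightarrow> (\<exists>g. is_inverse C f g)"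

definition inverse_of :: "('o, 'm, 'r) cat_scheme \<Rightarrow> 'm \<Rightarrow> 'm"
  where "inverse_of C f = (THE g. is_inverse C f g)"

record ('o, 'm) dagger_cat = "('o, 'm) cat" +
  dag :: "'m \<Rightarrow> 'm"  ("_\<^sup>\<dagger>\<index>" [1000] 999)

locale dagger_category = category C
  for C :: "('o, 'm, 'r) dagger_cat_scheme" (structure) +
  assumes dag_closed: "f \<in> hom C X Y \<Longrightarrow> f\<^sup>\<dagger> \<in> hom C Y X"
    and dag_ident: "X \<in> Ob C \<Longrightarrow> (\<one> X)\<^sup>\<dagger> = \<one> X"
    and dag_compose: "\<lbrakk>g \<in> hom C Y Z; f \<in> hom C X Y\<rbrakk> \<Longrightarrow> (g \<cdot> f)\<^sup>\<dagger> = f\<^sup>\<dagger> \<cdot> g\<^sup>\<dagger>"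
    and dag_dag: "f \<in> Arr C \<Longrightarrow> (f\<^sup>\<dagger>)\<^sup>\<dagger> = f"

definition unitary :: "('o, 'm, 'r) dagger_cat_scheme \<Rightarrow> 'm \<Rightarrow> bool"
  where "unitary C f \<longleftrightarrow> iso C f \<and> inverse_of C f = f\<^sup>\<dagger>\<^bsub>C\<^esub>"


section \<open>Symmetric monoidal structure\<close>

text \<open>The structure isomorphisms are oriented as
  \<open>\<a> X Y Z : (X \<boxtimes> Y) \<boxtimes> Z \<rightarrow> X \<boxtimes> (Y \<boxtimes> Z)\<close>, \<open>\<l> X : \<I> \<boxtimes> X \<rightarrow> X\<close>, \<open>\<r> X : X \<boxtimes> \<I> \<rightarrow> X\<close>
  and \<open>\<s> X Y : X \<boxtimes> Y \<rightarrow> Y \<boxtimes> X\<close>; \<open>\<boxtimes>\<close> is the tensor on objects, \<open>\<otimes>\<close> the tensor on arrows.\<close>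

record ('o, 'm) dagger_monoidal_cat = "('o, 'm) dagger_cat" +
  unit_ob :: "'o"  ("\<I>\<index>")
  tensor_ob :: "'o \<Rightarrow> 'o \<Rightarrow> 'o"  (infixr "\<boxtimes>\<index>" 75)
  tensor :: "'m \<Rightarrow> 'm \<Rightarrow> 'm"  (infixr "\<otimes>\<index>" 70)
  associator :: "'o \<Rightarrow> 'o \<Rightarrow> 'o \<Rightarrow> 'm"  ("\<a>\<index>")
  left_unitor :: "'o \<Rightarrow> 'm"  ("\<l>\<index>")
  right_unitor :: "'o \<Rightarrow> 'm"  ("\<r>\<index>")
  symmetry :: "'o \<Rightarrow> 'o \<Rightarrow> 'm"  ("\<s>\<index>")

locale symmetric_monoidal_category = category C
  for C :: "('o, 'm, 'r) dagger_monoidal_cat_scheme" (structure) +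
  assumes unit_ob_closed: "\<I> \<in> Ob C"
    and tensor_ob_closed: "\<lbrakk>X \<in> Ob C; Y \<in> Ob C\<rbrakk> \<Longrightarrow> X \<boxtimes> Y \<in> Ob C"
    and tensor_closed: "\<lbrakk>f \<in> hom C X X'; g \<in> hom C Y Y'\<rbrakk>
          \<Longrightarrow> f \<otimes> g \<in> hom C (X \<boxtimes> Y) (X' \<boxtimes> Y')"
    and tensor_ident: "\<lbrakk>X \<in> Ob C; Y \<in> Ob C\<rbrakk> \<Longrightarrow> \<one> X \<otimes> \<one> Y = \<one> (X \<boxtimes> Y)"
    and tensor_compose: "\<lbrakk>f' \<in> hom C X' X''; f \<in> hom C X X'; g' \<in> hom C Y' Y''; g \<in> hom C Y Y'\<rbrakk>
          \<Longrightarrow> (f' \<cdot> f) \<otimes> (g' \<cdot> g) = (f' \<otimes> g') \<cdot> (f \<otimes> g)"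
    and associator_closed: "\<lbrakk>X \<in> Ob C; Y \<in> Ob C; Z \<in> Ob C\<rbrakk>
          \<Longrightarrow> \<a> X Y Z \<in> hom C ((X \<boxtimes> Y) \<boxtimes> Z) (X \<boxtimes> (Y \<boxtimes> Z))"
    and associator_iso: "\<lbrakk>X \<in> Ob C; Y \<in> Ob C; Z \<in> Ob C\<rbrakk> \<Longrightarrow> iso C (\<a> X Y Z)"
    and associator_natural: "\<lbrakk>f \<in> hom C X X'; g \<in> hom C Y Y'; h \<in> hom C Z Z'\<rbrakk>
          \<Longrightarrow> \<a> X' Y' Z' \<cdot> ((f \<otimes> g) \<otimes> h) = (f \<otimes> (g \<otimes> h)) \<cdot> \<a> X Y Z"
    and left_unitor_closed: "X \<in> Ob C \<Longrightarrow> \<l> X \<in> hom C (\<I> \<boxtimes> X) X"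
    and left_unitor_iso: "X \<in> Ob C \<Longrightarrow> iso C (\<l> X)"
    and left_unitor_natural: "f \<in> hom C X Y \<Longrightarrow> \<l> Y \<cdot> (\<one> \<I> \<otimes> f) = f \<cdot> \<l> X"
    and right_unitor_closed: "X \<in> Ob C \<Longrightarrow> \<r> X \<in> hom C (X \<boxtimes> \<I>) X"
    and right_unitor_iso: "X \<in> Ob C \<Longrightarrow> iso C (\<r> X)"
    and right_unitor_natural: "f \<in> hom C X Y \<Longrightarrow> \<r> Y \<cdot> (f \<otimes> \<one> \<I>) = f \<cdot> \<r> X"
    and symmetry_closed: "\<lbrakk>X \<in> Ob C; Y \<in> Ob C\<rbrakk> \<Longrightarrow> \<s> X Y \<in> hom C (X \<boxtimes> Y) (Y \<boxtimes> X)"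
    and symmetry_natural: "\<lbrakk>f \<in> hom C X X'; g \<in> hom C Y Y'\<rbrakk>
          \<Longrightarrow> \<s> X' Y' \<cdot> (f \<otimes> g) = (g \<otimes> f) \<cdot> \<s> X Y"
    and symmetry_symmetry: "\<lbrakk>X \<in> Ob C; Y \<in> Ob C\<rbrakk> \<Longrightarrow> \<s> Y X \<cdot> \<s> X Y = \<one> (X \<boxtimes> Y)"
    and pentagon: "\<lbrakk>W \<in> Ob C; X \<in> Ob C; Y \<in> Ob C; Z \<in> Ob C\<rbrakk>
          \<Longrightarrow> \<a> W X (Y \<boxtimes> Z) \<cdot> \<a> (W \<boxtimes> X) Y Z
            = (\<one> W \<otimes> \<a> X Y Z) \<cdot> \<a> W (X \<boxtimes> Y) Z \<cdot> (\<a> W X Y \<otimes> \<one> Z)"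
    and triangle: "\<lbrakk>X \<in> Ob C; Y \<in> Ob C\<rbrakk>
          \<Longrightarrow> (\<one> X \<otimes> \<l> Y) \<cdot> \<a> X \<I> Y = \<r> X \<otimes> \<one> Y"
    and hexagon: "\<lbrakk>X \<in> Ob C; Y \<in> Ob C; Z \<in> Ob C\<rbrakk>
          \<Longrightarrow> \<a> Y Z X \<cdot> \<s> X (Y \<boxtimes> Z) \<cdot> \<a> X Y Z
            = (\<one> Y \<otimes> \<s> X Z) \<cdot> \<a> Y X Z \<cdot> (\<s> X Y \<otimes> \<one> Z)"
    and symmetry_unit: "X \<in> Ob C \<Longrightarrow> \<l> X \<cdot> \<s> X \<I> = \<r> X"

locale dagger_symmetric_monoidal_category = symmetric_monoidal_category C + dagger_category C
  for C :: "('o, 'm, 'r) dagger_monoidal_cat_scheme" (structure) +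
  assumes dag_tensor: "\<lbrakk>f \<in> Arr C; g \<in> Arr C\<rbrakk> \<Longrightarrow> (f \<otimes> g)\<^sup>\<dagger> = f\<^sup>\<dagger> \<otimes> g\<^sup>\<dagger>"
    and associator_unitary: "\<lbrakk>X \<in> Ob C; Y \<in> Ob C; Z \<in> Ob C\<rbrakk> \<Longrightarrow> unitary C (\<a> X Y Z)"
    and left_unitor_unitary: "X \<in> Ob C \<Longrightarrow> unitary C (\<l> X)"
    and right_unitor_unitary: "X \<in> Ob C \<Longrightarrow> unitary C (\<r> X)"
    and symmetry_unitary: "\<lbrakk>X \<in> Ob C; Y \<in> Ob C\<rbrakk> \<Longrightarrow> unitary C (\<s> X Y)"

definition monoidally_well_pointed :: "('o, 'm, 'r) dagger_monoidal_cat_scheme \<Rightarrow> bool"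
  where "monoidally_well_pointed C \<longleftrightarrow>
    (\<forall>X\<in>Ob C. \<forall>Y\<in>Ob C. \<forall>Z\<in>Ob C. \<forall>f\<in>hom C (X \<boxtimes>\<^bsub>C\<^esub> Y) Z. \<forall>g\<in>hom C (X \<boxtimes>\<^bsub>C\<^esub> Y) Z.
      (\<forall>x\<in>hom C \<I>\<^bsub>C\<^esub> X. \<forall>y\<in>hom C \<I>\<^bsub>C\<^esub> Y. f \<cdot>\<^bsub>C\<^esub> (x \<otimes>\<^bsub>C\<^esub> y) = g \<cdot>\<^bsub>C\<^esub> (x \<otimes>\<^bsub>C\<^esub> y)) \<longrightarrow> f = g)"


section \<open>Dagger biproducts and addition of arrows\<close>

record ('o, 'm) dagger_biprod_cat = "('o, 'm) dagger_monoidal_cat" +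
  zero_ob :: "'o"
  biprod_ob :: "'o \<Rightarrow> 'o \<Rightarrow> 'o"  (infixr "\<oplus>\<index>" 65)
  coproj1 :: "'o \<Rightarrow> 'o \<Rightarrow> 'm"
  coproj2 :: "'o \<Rightarrow> 'o \<Rightarrow> 'm"
  proj1 :: "'o \<Rightarrow> 'o \<Rightarrow> 'm"
  proj2 :: "'o \<Rightarrow> 'o \<Rightarrow> 'm"

context
  fixes C :: "('o, 'm, 'r) dagger_biprod_cat_scheme" (structure)
begin

definition zero_arr :: "'o \<Rightarrow> 'o \<Rightarrow> 'm"
  where "zero_arr X Y =
    (THE f. f \<in> hom C (zero_ob C) Y) \<cdot> (THE f. f \<in> hom C X (zero_ob C))"

definition pairing :: "'m \<Rightarrow> 'm \<Rightarrow> 'm"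
  where "pairing f g = (THE h. h \<in> hom C (Dom C f) (Cod C f \<oplus> Cod C g) \<and>
    proj1 C (Cod C f) (Cod C g) \<cdot> h = f \<and> proj2 C (Cod C f) (Cod C g) \<cdot> h = g)"

definition copairing :: "'m \<Rightarrow> 'm \<Rightarrow> 'm"
  where "copairing f g = (THE h. h \<in> hom C (Dom C f \<oplus> Dom C g) (Cod C f) \<and>
    h \<cdot> coproj1 C (Dom C f) (Dom C g) = f \<and> h \<cdot> coproj2 C (Dom C f) (Dom C g) = g)"

definition diagonal :: "'o \<Rightarrow> 'm"
  where "diagonal X = pairing (\<one> X) (\<one> X)"

definition codiagonal :: "'o \<Rightarrow> 'm"
  where "codiagonal X = copairing (\<one> X) (\<one> X)"

definition biprod_arr :: "'m \<Rightarrow> 'm \<Rightarrow> 'm"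
  where "biprod_arr f g = pairing (f \<cdot> proj1 C (Dom C f) (Dom C g)) (g \<cdot> proj2 C (Dom C f) (Dom C g))"

definition add_arr :: "'m \<Rightarrow> 'm \<Rightarrow> 'm"
  where "add_arr f g = codiagonal (Cod C f) \<cdot> biprod_arr f g \<cdot> diagonal (Dom C f)"

definition scalar_mult :: "'m \<Rightarrow> 'm \<Rightarrow> 'm"
  where "scalar_mult s f = \<r> (Cod C f) \<cdot> (f \<otimes> s) \<cdot> inverse_of C (\<r> (Dom C f))"

end

locale dagger_biproduct_category = dagger_symmetric_monoidal_category C
  for C :: "('o, 'm, 'r) dagger_biprod_cat_scheme" (structure) +
  assumes zero_ob_closed: "zero_ob C \<in> Ob C"
    and zero_ob_terminal: "X \<in> Ob C \<Longrightarrow> \<exists>!f. f \<in> hom C X (zero_ob C)"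
    and zero_ob_initial: "X \<in> Ob C \<Longrightarrow> \<exists>!f. f \<in> hom C (zero_ob C) X"
    and biprod_ob_closed: "\<lbrakk>X \<in> Ob C; Y \<in> Ob C\<rbrakk> \<Longrightarrow> X \<oplus> Y \<in> Ob C"
    and coproj1_closed: "\<lbrakk>X \<in> Ob C; Y \<in> Ob C\<rbrakk> \<Longrightarrow> coproj1 C X Y \<in> hom C X (X \<oplus> Y)"
    and coproj2_closed: "\<lbrakk>X \<in> Ob C; Y \<in> Ob C\<rbrakk> \<Longrightarrow> coproj2 C X Y \<in> hom C Y (X \<oplus> Y)"
    and proj1_closed: "\<lbrakk>X \<in> Ob C; Y \<in> Ob C\<rbrakk> \<Longrightarrow> proj1 C X Y \<in> hom C (X \<oplus> Y) X"
    and proj2_closed: "\<lbrakk>X \<in> Ob C; Y \<in> Ob C\<rbrakk> \<Longrightarrow> proj2 C X Y \<in> hom C (X \<oplus> Y) Y"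
    and biprod_product: "\<lbrakk>X \<in> Ob C; Y \<in> Ob C; f \<in> hom C A X; g \<in> hom C A Y\<rbrakk>
          \<Longrightarrow> \<exists>!h. h \<in> hom C A (X \<oplus> Y) \<and> proj1 C X Y \<cdot> h = f \<and> proj2 C X Y \<cdot> h = g"
    and biprod_coproduct: "\<lbrakk>X \<in> Ob C; Y \<in> Ob C; f \<in> hom C X A; g \<in> hom C Y A\<rbrakk>
          \<Longrightarrow> \<exists>!h. h \<in> hom C (X \<oplus> Y) A \<and> h \<cdot> coproj1 C X Y = f \<and> h \<cdot> coproj2 C X Y = g"
    and proj1_coproj1: "\<lbrakk>X \<in> Ob C; Y \<in> Ob C\<rbrakk> \<Longrightarrow> proj1 C X Y \<cdot> coproj1 C X Y = \<one> X"
    and proj2_coproj2: "\<lbrakk>X \<in> Ob C; Y \<in> Ob C\<rbrakk> \<Longrightarrow> proj2 C X Y \<cdot> coproj2 C X Y = \<one> Y"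
    and proj1_coproj2: "\<lbrakk>X \<in> Ob C; Y \<in> Ob C\<rbrakk> \<Longrightarrow> proj1 C X Y \<cdot> coproj2 C X Y = zero_arr C Y X"
    and proj2_coproj1: "\<lbrakk>X \<in> Ob C; Y \<in> Ob C\<rbrakk> \<Longrightarrow> proj2 C X Y \<cdot> coproj1 C X Y = zero_arr C X Y"
    and dag_coproj1: "\<lbrakk>X \<in> Ob C; Y \<in> Ob C\<rbrakk> \<Longrightarrow> (coproj1 C X Y)\<^sup>\<dagger> = proj1 C X Y"
    and dag_coproj2: "\<lbrakk>X \<in> Ob C; Y \<in> Ob C\<rbrakk> \<Longrightarrow> (coproj2 C X Y)\<^sup>\<dagger> = proj2 C X Y"


section \<open>Subsemialgebras of endomorphisms\<close>

context
  fixes C :: "('o, 'm, 'r) dagger_biprod_cat_scheme" (structure) and X :: 'o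
begin

definition subsemialgebra :: "'m set \<Rightarrow> bool"
  where "subsemialgebra A \<longleftrightarrow> A \<subseteq> hom C X X \<and> zero_arr C X X \<in> A \<and> \<one> X \<in> A \<and>
    (\<forall>f\<in>A. \<forall>g\<in>A. add_arr C f g \<in> A) \<and> (\<forall>f\<in>A. \<forall>g\<in>A. f \<cdot> g \<in> A) \<and>
    (\<forall>s\<in>hom C \<I> \<I>. \<forall>f\<in>A. scalar_mult C s f \<in> A)"

definition star_subsemialgebra :: "'m set \<Rightarrow> bool"
  where "star_subsemialgebra A \<longleftrightarrow> subsemialgebra A \<and> (\<forall>f\<in>A. f\<^sup>\<dagger> \<in> A)"

definition commutative_set :: "'m set \<Rightarrow> bool"
  where "commutative_set A \<longleftrightarrow> (\<forall>f\<in>A. \<forall>g\<in>A. f \<cdot> g = g \<cdot> f)"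

definition commutant :: "'m set \<Rightarrow> 'm set"
  where "commutant B = {f \<in> hom C X X. \<forall>g\<in>B. f \<cdot> g = g \<cdot> f}"

definition commutative_von_Neumann_semialgebra :: "'m set \<Rightarrow> bool"
  where "commutative_von_Neumann_semialgebra A \<longleftrightarrow>
    star_subsemialgebra A \<and> commutative_set A \<and> A = commutant (commutant A)"

text \<open>Maximality is tested against all commutative subsemialgebras, not only those closed under
  the dagger; this is the reading under which maximality amounts to \<open>A = commutant A\<close>.\<close>

definition maximal_commutative_von_Neumann_semialgebra :: "'m set \<Rightarrow> bool"
  where "maximal_commutative_von_Neumann_semialgebra A \<longleftrightarrow>
    commutative_von_Neumann_semialgebra A \<and>
    \<not> (\<exists>B. subsemialgebra B \<and> commutative_set B \<and> A \<subset> B)"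

end


section \<open>H*-algebras\<close>

context
  fixes C :: "('o, 'm, 'r) dagger_monoidal_cat_scheme" (structure) and X :: 'o and \<mu> :: 'm
begin

definition mult_by :: "'m \<Rightarrow> 'm"
  where "mult_by x = \<mu> \<cdot> (x \<otimes> \<one> X) \<cdot> inverse_of C (\<l> X)"

definition mult_operators :: "'m set"
  where "mult_operators = {mult_by x | x. x \<in> hom C \<I> X}"

definition H_star_algebra :: bool
  where "H_star_algebra \<longleftrightarrow> X \<in> Ob C \<and> \<mu> \<in> hom C (X \<boxtimes> X) X \<and>
    \<mu> \<cdot> (\<mu> \<otimes> \<one> X) = \<mu> \<cdot> (\<one> X \<otimes> \<mu>) \<cdot> \<a> X X X \<and>
    \<mu> \<cdot> \<s> X X = \<mu> \<and>
    \<mu> \<cdot> \<mu>\<^sup>\<dagger> = \<one> X \<and>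
    (\<forall>x\<in>hom C \<I> X. \<exists>x'\<in>hom C X \<I>.
      \<mu> \<cdot> (x \<otimes> \<one> X) \<cdot> inverse_of C (\<l> X) = \<r> X \<cdot> (\<one> X \<otimes> x') \<cdot> \<mu>\<^sup>\<dagger>)"

definition unit_axiom :: bool
  where "unit_axiom \<longleftrightarrow> (\<exists>\<eta>\<in>hom C \<I> X.
    \<mu> \<cdot> (\<eta> \<otimes> \<one> X) \<cdot> inverse_of C (\<l> X) = \<one> X \<and>
    \<mu> \<cdot> (\<one> X \<otimes> \<eta>) \<cdot> inverse_of C (\<r> X) = \<one> X)"

end

end

theory Submission
  imports Defs
begin

text \<open>
  By well-pointedness, \<open>f\<close> lies in the commutant \<open>A\<close> of the multiplication operators iff it is
  \<open>X\<close>-linear: \<open>f \<cdot> \<mu> = \<mu> \<cdot> (\<one> X \<otimes> f) = \<mu> \<cdot> (f \<otimes> \<one> X)\<close>. Hence \<open>f \<cdot> g \<cdot> \<mu> = \<mu> \<cdot> (f \<otimes> g) = g \<cdot> f \<cdot> \<mu>\<close> for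
  \<open>f\<close>, \<open>g\<close> in \<open>A\<close>, and since \<open>\<mu>\<close> is split epi by axiom (S), \<open>A\<close> is commutative. The multiplication
  operators commute with each other, so they lie in \<open>A\<close>, and \<open>A\<close> is therefore its own commutant;
  it is closed under the dagger because axiom (H) makes the multiplication operators so. With a
  unit \<open>\<eta>\<close>, linearity gives that \<open>f\<close> is multiplication by \<open>f \<cdot> \<eta>\<close>.
\<close>

section \<open>Typing of arrows, associativity and inverses in a category\<close>

context category
begin

lemma homD:
  assumes "f \<in> hom C X Y"
  shows "f \<in> Arr C" "Dom C f = X" "Cod C f = Y" "X \<in> Ob C" "Y \<in> Ob C"
  using assms dom_closed cod_closed by (auto simp: hom_def)

lemma homI:
  assumes "f \<in> Arr C" "Dom C f = X" "Cod C f = Y"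
  shows "f \<in> hom C X Y"
  using assms by (simp add: hom_def)

text \<open>Typing is carried by \<open>Arr\<close>, \<open>Dom\<close> and \<open>Cod\<close>
  instead of \<open>hom\<close>, so that the simplifier can compute the domain and codomain of any
  composite and discharge side conditions itself. Together with \<open>assoc\<close> this brings
  composites to right-nested form.\<close>

lemma compose_simps [simp]:
  assumes "g \<in> Arr C" "f \<in> Arr C" "Dom C g = Cod C f"
  shows "g \<cdot> f \<in> Arr C" "Dom C (g \<cdot> f) = Dom C f" "Cod C (g \<cdot> f) = Cod C g"
  using compose_closed[of g "Cod C f" "Cod C g" f "Dom C f"] assms by (simp_all add: hom_def)

lemma ident_simps [simp]:
  assumes "X \<in> Ob C"
  shows "\<one> X \<in> Arr C" "Dom C (\<one> X) = X" "Cod C (\<one> X) = X"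
  using ident_closed[OF assms] by (simp_all add: hom_def)

lemma assoc [simp]:
  assumes "h \<in> Arr C" "g \<in> Arr C" "f \<in> Arr C" "Dom C h = Cod C g" "Dom C g = Cod C f"
  shows "(h \<cdot> g) \<cdot> f = h \<cdot> g \<cdot> f"
  by (rule compose_assoc[of _ "Cod C g" "Cod C h" _ "Dom C g" _ "Dom C f"])
    (use assms in \<open>simp_all add: hom_def\<close>)

lemma ident_cancel [simp]:
  assumes "f \<in> Arr C"
  shows "Cod C f = Y \<Longrightarrow> \<one> Y \<cdot> f = f" "Dom C f = X \<Longrightarrow> f \<cdot> \<one> X = f"
  using ident_left[of f "Dom C f" "Cod C f"] ident_right[of f "Dom C f" "Cod C f"] assms
  by (auto simp: hom_def)

lemma is_inverse_unique:
  assumes "is_inverse C f g" "is_inverse C f h"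
  shows "g = h"
proof -
  have fg: "f \<in> Arr C" "g \<in> Arr C" "Dom C g = Cod C f" "Cod C g = Dom C f"
    "h \<in> Arr C" "Dom C h = Cod C f" "Cod C h = Dom C f"
    "g \<cdot> f = \<one> (Dom C f)" "f \<cdot> h = \<one> (Cod C f)"
    using assms by (simp_all add: is_inverse_def hom_def)
  have "g = g \<cdot> f \<cdot> h" using fg by simp
  also have "\<dots> = (g \<cdot> f) \<cdot> h" using fg by (subst assoc) auto
  also have "\<dots> = h" using fg by simp
  finally show ?thesis .
qed

lemma inverse_of_is_inverse:
  assumes "iso C f"
  shows "is_inverse C f (inverse_of C f)"
proof -
  obtain g where "is_inverse C f g" using assms by (auto simp: iso_def)
  then show ?thesis
    unfolding inverse_of_def by (rule theI) (blast intro: is_inverse_unique \<open>is_inverse C f g\<close>)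
qed

lemma inverse_of_simps:
  assumes "iso C f"
  shows "inverse_of C f \<in> Arr C" "Dom C (inverse_of C f) = Cod C f"
    "Cod C (inverse_of C f) = Dom C f"
    "inverse_of C f \<cdot> f = \<one> (Dom C f)" "f \<cdot> inverse_of C f = \<one> (Cod C f)"
  using inverse_of_is_inverse[OF assms] by (auto simp: is_inverse_def hom_def)

text \<open>Adapted to right-nested composites: there an arrow and its inverse are adjacent only as
  the head of a longer composite with tail \<open>k\<close>.\<close>

lemma inverse_of_cancel:
  assumes "iso C f" "f \<in> Arr C" "k \<in> Arr C"
  shows "Cod C k = Dom C f \<Longrightarrow> inverse_of C f \<cdot> f \<cdot> k = k"
    "Cod C k = Cod C f \<Longrightarrow> f \<cdot> inverse_of C f \<cdot> k = k"
proof -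
  note [simp] = assms inverse_of_simps[OF assms(1)]
  show "inverse_of C f \<cdot> f \<cdot> k = k" if [simp]: "Cod C k = Dom C f"
    by (subst assoc[symmetric]) (simp_all del: assoc)
  show "f \<cdot> inverse_of C f \<cdot> k = k" if [simp]: "Cod C k = Cod C f"
    by (subst assoc[symmetric]) (simp_all del: assoc)
qed

lemma iso_epi:
  assumes "iso C f" "f \<in> Arr C" "g \<in> Arr C" "h \<in> Arr C"
    "Dom C g = Cod C f" "Dom C h = Cod C f" "g \<cdot> f = h \<cdot> f"
  shows "g = h"
proof -
  have "g \<cdot> f \<cdot> inverse_of C f = (g \<cdot> f) \<cdot> inverse_of C f"
    using assms(1-6) inverse_of_simps[OF assms(1)] by simp
  also have "\<dots> = h \<cdot> f \<cdot> inverse_of C f"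
    unfolding assms(7) using assms(1-6) inverse_of_simps[OF assms(1)] by simp
  finally show ?thesis using assms(1-6) inverse_of_simps[OF assms(1)] by simp
qed

lemma iso_mono:
  assumes "iso C f" "f \<in> Arr C" "g \<in> Arr C" "h \<in> Arr C"
    "Cod C g = Dom C f" "Cod C h = Dom C f" "f \<cdot> g = f \<cdot> h"
  shows "g = h"
  using inverse_of_cancel(1)[OF assms(1-3,5)] inverse_of_cancel(1)[OF assms(1,2,4,6)] assms(7)
  by metis

end

section \<open>Interchange, inverse unitors and unit coherence in a symmetric monoidal
  category\<close>

context symmetric_monoidal_category
begin

lemma tensor_simps [simp]:
  assumes "f \<in> Arr C" "g \<in> Arr C"
  shows "f \<otimes> g \<in> Arr C" "Dom C (f \<otimes> g) = Dom C f \<boxtimes> Dom C g"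
    "Cod C (f \<otimes> g) = Cod C f \<boxtimes> Cod C g"
  using tensor_closed[of f "Dom C f" "Cod C f" g "Dom C g" "Cod C g"] assms
  by (simp_all add: hom_def)

declare unit_ob_closed [simp] tensor_ob_closed [simp] tensor_ident [simp]

lemma structure_simps [simp]:
  assumes "X \<in> Ob C"
  shows "\<l> X \<in> Arr C" "Dom C (\<l> X) = \<I> \<boxtimes> X" "Cod C (\<l> X) = X"
    and "\<r> X \<in> Arr C" "Dom C (\<r> X) = X \<boxtimes> \<I>" "Cod C (\<r> X) = X"
    and "Y \<in> Ob C \<Longrightarrow> \<s> X Y \<in> Arr C" "Y \<in> Ob C \<Longrightarrow> Dom C (\<s> X Y) = X \<boxtimes> Y"
      "Y \<in> Ob C \<Longrightarrow> Cod C (\<s> X Y) = Y \<boxtimes> X"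
    and "\<lbrakk>Y \<in> Ob C; Z \<in> Ob C\<rbrakk> \<Longrightarrow> \<a> X Y Z \<in> Arr C"
      "\<lbrakk>Y \<in> Ob C; Z \<in> Ob C\<rbrakk> \<Longrightarrow> Dom C (\<a> X Y Z) = (X \<boxtimes> Y) \<boxtimes> Z"
      "\<lbrakk>Y \<in> Ob C; Z \<in> Ob C\<rbrakk> \<Longrightarrow> Cod C (\<a> X Y Z) = X \<boxtimes> (Y \<boxtimes> Z)"
  using left_unitor_closed[of X] right_unitor_closed[of X] symmetry_closed[of X Y]
    associator_closed[of X Y Z] assms
  by (simp_all add: hom_def)

abbreviation left_unitor_inv ("\<l>\<^sup>-") where "\<l>\<^sup>- X \<equiv> inverse_of C (\<l> X)"
abbreviation right_unitor_inv ("\<r>\<^sup>-") where "\<r>\<^sup>- X \<equiv> inverse_of C (\<r> X)"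

lemma unitor_inv_simps [simp]:
  assumes "X \<in> Ob C"
  shows "\<l>\<^sup>- X \<in> Arr C" "Dom C (\<l>\<^sup>- X) = X" "Cod C (\<l>\<^sup>- X) = \<I> \<boxtimes> X"
    and "\<r>\<^sup>- X \<in> Arr C" "Dom C (\<r>\<^sup>- X) = X" "Cod C (\<r>\<^sup>- X) = X \<boxtimes> \<I>"
    and "\<l> X \<cdot> \<l>\<^sup>- X = \<one> X" "\<l>\<^sup>- X \<cdot> \<l> X = \<one> (\<I> \<boxtimes> X)"
    and "\<r> X \<cdot> \<r>\<^sup>- X = \<one> X" "\<r>\<^sup>- X \<cdot> \<r> X = \<one> (X \<boxtimes> \<I>)"
  using inverse_of_simps[OF left_unitor_iso[OF assms]]
    inverse_of_simps[OF right_unitor_iso[OF assms]] assms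
  by simp_all

lemma interchange:
  assumes "f' \<in> Arr C" "f \<in> Arr C" "g' \<in> Arr C" "g \<in> Arr C"
    "Dom C f' = Cod C f" "Dom C g' = Cod C g"
  shows "(f' \<otimes> g') \<cdot> (f \<otimes> g) = (f' \<cdot> f) \<otimes> (g' \<cdot> g)"
  by (rule tensor_compose[symmetric]) (use assms in \<open>auto intro: homI\<close>)

text \<open>The interchange law in front of a tail \<open>k\<close>, as needed for composites nested
  to the right.\<close>

lemma interchange_assoc:
  assumes "f' \<in> Arr C" "f \<in> Arr C" "g' \<in> Arr C" "g \<in> Arr C" "k \<in> Arr C"
    "Dom C f' = Cod C f" "Dom C g' = Cod C g" "Cod C k = Dom C f \<boxtimes> Dom C g"
  shows "(f' \<otimes> g') \<cdot> (f \<otimes> g) \<cdot> k = ((f' \<cdot> f) \<otimes> (g' \<cdot> g)) \<cdot> k"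
  using assms assoc[of "f' \<otimes> g'" "f \<otimes> g" k] interchange[of f' f g' g] by simp

text \<open>Both sides agree after composition with the isomorphism \<open>\<l> (Cod C f)\<close>:
  one side cancels, the other reduces by naturality of \<open>\<l>\<close>.\<close>

lemma left_unitor_inv_natural:
  assumes "f \<in> Arr C"
  shows "\<l>\<^sup>- (Cod C f) \<cdot> f = (\<one> \<I> \<otimes> f) \<cdot> \<l>\<^sup>- (Dom C f)"
proof (rule iso_mono[OF left_unitor_iso[of "Cod C f"]])
  note [simp] = assms dom_closed cod_closed
  have "\<l> (Cod C f) \<cdot> (\<one> \<I> \<otimes> f) \<cdot> \<l>\<^sup>- (Dom C f) = (\<l> (Cod C f) \<cdot> (\<one> \<I> \<otimes> f)) \<cdot> \<l>\<^sup>- (Dom C f)"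
    by simp
  also have "\<dots> = (f \<cdot> \<l> (Dom C f)) \<cdot> \<l>\<^sup>- (Dom C f)"
    by (simp only: left_unitor_natural[OF homI[OF assms refl refl]])
  finally show "\<l> (Cod C f) \<cdot> \<l>\<^sup>- (Cod C f) \<cdot> f = \<l> (Cod C f) \<cdot> (\<one> \<I> \<otimes> f) \<cdot> \<l>\<^sup>- (Dom C f)"
    using inverse_of_cancel(2)[OF left_unitor_iso, of "Cod C f" f] by simp
qed (use assms dom_closed[of f] cod_closed[of f] in simp_all)

lemma right_unitor_inv_natural:
  assumes "f \<in> Arr C"
  shows "\<r>\<^sup>- (Cod C f) \<cdot> f = (f \<otimes> \<one> \<I>) \<cdot> \<r>\<^sup>- (Dom C f)"
proof (rule iso_mono[OF right_unitor_iso[of "Cod C f"]])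
  note [simp] = assms dom_closed cod_closed
  have "\<r> (Cod C f) \<cdot> (f \<otimes> \<one> \<I>) \<cdot> \<r>\<^sup>- (Dom C f) = (\<r> (Cod C f) \<cdot> (f \<otimes> \<one> \<I>)) \<cdot> \<r>\<^sup>- (Dom C f)"
    by simp
  also have "\<dots> = (f \<cdot> \<r> (Dom C f)) \<cdot> \<r>\<^sup>- (Dom C f)"
    by (simp only: right_unitor_natural[OF homI[OF assms refl refl]])
  finally show "\<r> (Cod C f) \<cdot> \<r>\<^sup>- (Cod C f) \<cdot> f = \<r> (Cod C f) \<cdot> (f \<otimes> \<one> \<I>) \<cdot> \<r>\<^sup>- (Dom C f)"
    using inverse_of_cancel(2)[OF right_unitor_iso, of "Cod C f" f] by simp
qed (use assms dom_closed[of f] cod_closed[of f] in simp_all)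

text \<open>Naturality of \<open>\<l>\<close> determines \<open>f \<cdot> \<l> (Dom C f)\<close>
  from \<open>\<one> \<I> \<otimes> f\<close>, and \<open>\<l>\<close> is epi. This is what allows
  coherence equations to be proved after tensoring with \<open>\<one> \<I>\<close>.\<close>

lemma unit_tensor_faithful:
  assumes "f \<in> Arr C" "g \<in> Arr C" "Dom C f = Dom C g" "Cod C f = Cod C g"
    "\<one> \<I> \<otimes> f = \<one> \<I> \<otimes> g"
  shows "f = g"
proof (rule iso_epi[OF left_unitor_iso[of "Dom C f"]])
  show "f \<cdot> \<l> (Dom C f) = g \<cdot> \<l> (Dom C f)"
    using left_unitor_natural[OF homI[OF assms(1) refl refl]]
      left_unitor_natural[OF homI[OF assms(2) refl refl]] assms by simp
qed (use assms dom_closed[of f] in simp_all)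

lemma tensor_unit_faithful:
  assumes "f \<in> Arr C" "g \<in> Arr C" "Dom C f = Dom C g" "Cod C f = Cod C g"
    "f \<otimes> \<one> \<I> = g \<otimes> \<one> \<I>"
  shows "f = g"
proof (rule iso_epi[OF right_unitor_iso[of "Dom C f"]])
  show "f \<cdot> \<r> (Dom C f) = g \<cdot> \<r> (Dom C f)"
    using right_unitor_natural[OF homI[OF assms(1) refl refl]]
      right_unitor_natural[OF homI[OF assms(2) refl refl]] assms by simp
qed (use assms dom_closed[of f] in simp_all)

lemma iso_tensor_ident:
  assumes "iso C f" "f \<in> Arr C" "Y \<in> Ob C"
  shows "iso C (f \<otimes> \<one> Y)"
proof -
  have "is_inverse C (f \<otimes> \<one> Y) (inverse_of C f \<otimes> \<one> Y)"
    using assms inverse_of_simps[OF assms(1)] dom_closed[of f] cod_closed[of f]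
    by (simp add: is_inverse_def homI interchange)
  then show ?thesis by (auto simp: iso_def)
qed

text \<open>Kelly's coherence lemma: both sides agree after tensoring with \<open>\<one> \<I>\<close> and precomposing with
  associators, by the pentagon and two triangles.\<close>

lemma left_unitor_tensor:
  assumes "X \<in> Ob C" "Y \<in> Ob C"
  shows "\<l> (X \<boxtimes> Y) \<cdot> \<a> \<I> X Y = \<l> X \<otimes> \<one> Y"
proof (rule unit_tensor_faithful)
  have "(\<one> \<I> \<otimes> (\<l> (X \<boxtimes> Y) \<cdot> \<a> \<I> X Y)) \<cdot> \<a> \<I> (\<I> \<boxtimes> X) Y \<cdot> (\<a> \<I> \<I> X \<otimes> \<one> Y)
      = (\<one> \<I> \<otimes> \<l> (X \<boxtimes> Y)) \<cdot> (\<one> \<I> \<otimes> \<a> \<I> X Y) \<cdot> \<a> \<I> (\<I> \<boxtimes> X) Y \<cdot> (\<a> \<I> \<I> X \<otimes> \<one> Y)"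
    using assms by (subst interchange_assoc) simp_all
  also have "\<dots> = ((\<one> \<I> \<otimes> \<l> (X \<boxtimes> Y)) \<cdot> \<a> \<I> \<I> (X \<boxtimes> Y)) \<cdot> \<a> (\<I> \<boxtimes> \<I>) X Y"
    using assms by (simp add: pentagon)
  also have "\<dots> = (\<r> \<I> \<otimes> (\<one> X \<otimes> \<one> Y)) \<cdot> \<a> (\<I> \<boxtimes> \<I>) X Y"
    using assms by (subst triangle) simp_all
  also have "\<dots> = \<a> \<I> X Y \<cdot> ((\<r> \<I> \<otimes> \<one> X) \<otimes> \<one> Y)"
    by (rule associator_natural[symmetric]) (use assms in \<open>auto intro: homI\<close>)
  also have "\<dots> = \<a> \<I> X Y \<cdot> ((\<one> \<I> \<otimes> \<l> X) \<otimes> \<one> Y) \<cdot> (\<a> \<I> \<I> X \<otimes> \<one> Y)"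
    using assms by (simp add: interchange triangle)
  also have "\<dots> = (\<a> \<I> X Y \<cdot> ((\<one> \<I> \<otimes> \<l> X) \<otimes> \<one> Y)) \<cdot> (\<a> \<I> \<I> X \<otimes> \<one> Y)"
    using assms by simp
  also have "\<dots> = ((\<one> \<I> \<otimes> (\<l> X \<otimes> \<one> Y)) \<cdot> \<a> \<I> (\<I> \<boxtimes> X) Y) \<cdot> (\<a> \<I> \<I> X \<otimes> \<one> Y)"
    by (subst associator_natural[of _ \<I> _ _ "\<I> \<boxtimes> X" _ _ Y])
      (use assms in \<open>auto intro: homI\<close>)
  finally have eq: "((\<one> \<I> \<otimes> (\<l> (X \<boxtimes> Y) \<cdot> \<a> \<I> X Y)) \<cdot> \<a> \<I> (\<I> \<boxtimes> X) Y) \<cdot> (\<a> \<I> \<I> X \<otimes> \<one> Y)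
      = ((\<one> \<I> \<otimes> (\<l> X \<otimes> \<one> Y)) \<cdot> \<a> \<I> (\<I> \<boxtimes> X) Y) \<cdot> (\<a> \<I> \<I> X \<otimes> \<one> Y)"
    using assms by simp
  have "(\<one> \<I> \<otimes> (\<l> (X \<boxtimes> Y) \<cdot> \<a> \<I> X Y)) \<cdot> \<a> \<I> (\<I> \<boxtimes> X) Y
      = (\<one> \<I> \<otimes> (\<l> X \<otimes> \<one> Y)) \<cdot> \<a> \<I> (\<I> \<boxtimes> X) Y"
    by (rule iso_epi[OF iso_tensor_ident[OF associator_iso[of \<I> \<I> X], of Y]])
      (use eq assms in simp_all)
  then show "\<one> \<I> \<otimes> (\<l> (X \<boxtimes> Y) \<cdot> \<a> \<I> X Y) = \<one> \<I> \<otimes> (\<l> X \<otimes> \<one> Y)"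
    by (rule iso_epi[OF associator_iso[of \<I> "\<I> \<boxtimes> X" Y], rotated -1]) (use assms in simp_all)
qed (use assms in simp_all)

text \<open>After tensoring with \<open>\<one> \<I>\<close>, both unitors equal \<open>(\<one> \<I>
  \<otimes> \<l> \<I>) \<cdot> \<a> \<I> \<I> \<I>\<close>, the right one by the triangle and the
  left one by \<open>left_unitor_tensor\<close>.\<close>

lemma left_unitor_unit: "\<l> \<I> = \<r> \<I>"
proof (rule tensor_unit_faithful)
  \<comment> \<open>Naturality of \<open>\<l>\<close> at the arrow \<open>\<l> \<I>\<close> itself,
    followed by cancelling \<open>\<l> \<I>\<close> on the left.\<close>
  have "\<l> (\<I> \<boxtimes> \<I>) = \<one> \<I> \<otimes> \<l> \<I>"
    by (rule iso_mono[OF left_unitor_iso[of \<I>]])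
      (simp_all add: left_unitor_natural[OF homI[of "\<l> \<I>" "\<I> \<boxtimes> \<I>" \<I>]])
  then show "\<l> \<I> \<otimes> \<one> \<I> = \<r> \<I> \<otimes> \<one> \<I>"
    using left_unitor_tensor[of \<I> \<I>] triangle[of \<I> \<I>] by simp
qed simp_all

text \<open>The axiom \<open>symmetry_unit\<close> gives
  \<open>\<l> \<I> \<cdot> \<s> \<I> \<I> = \<r> \<I>\<close>; since the two unitors agree at
  \<open>\<I>\<close>, cancelling \<open>\<l> \<I>\<close> leaves the identity.\<close>

lemma symmetry_unit_unit: "\<s> \<I> \<I> = \<one> (\<I> \<boxtimes> \<I>)"
  by (rule iso_mono[OF left_unitor_iso[of \<I>]])
    (simp_all add: symmetry_unit flip: left_unitor_unit)

lemma symmetry_right_unitor_inv: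
  assumes "X \<in> Ob C"
  shows "\<s> X \<I> \<cdot> \<r>\<^sup>- X = \<l>\<^sup>- X"
proof (rule iso_mono[OF left_unitor_iso[OF assms]])
  show "\<l> X \<cdot> \<s> X \<I> \<cdot> \<r>\<^sup>- X = \<l> X \<cdot> \<l>\<^sup>- X"
    using assms assoc[of "\<l> X" "\<s> X \<I>" "\<r>\<^sup>- X"] by (simp add: symmetry_unit)
qed (use assms in simp_all)

end

section \<open>Typing of the dagger\<close>

context dagger_symmetric_monoidal_category
begin

lemma dag_simps [simp]:
  assumes "f \<in> Arr C"
  shows "f\<^sup>\<dagger> \<in> Arr C" "Dom C (f\<^sup>\<dagger>) = Cod C f" "Cod C (f\<^sup>\<dagger>) = Dom C f"
  using dag_closed[OF homI[OF assms refl refl]] by (simp_all add: hom_def)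

lemma dag_comp:
  assumes "g \<in> Arr C" "f \<in> Arr C" "Dom C g = Cod C f"
  shows "(g \<cdot> f)\<^sup>\<dagger> = f\<^sup>\<dagger> \<cdot> g\<^sup>\<dagger>"
  by (rule dag_compose) (use assms in \<open>auto intro: homI\<close>)

end

section \<open>Bilinearity of composition: zero arrows, sums and scalar multiples\<close>

context dagger_biproduct_category
begin

lemma biproduct_simps [simp]:
  assumes "X \<in> Ob C" "Y \<in> Ob C"
  shows "X \<oplus> Y \<in> Ob C"
    and "proj1 C X Y \<in> Arr C" "Dom C (proj1 C X Y) = X \<oplus> Y" "Cod C (proj1 C X Y) = X"
    and "proj2 C X Y \<in> Arr C" "Dom C (proj2 C X Y) = X \<oplus> Y" "Cod C (proj2 C X Y) = Y"
    and "coproj1 C X Y \<in> Arr C" "Dom C (coproj1 C X Y) = X" "Cod C (coproj1 C X Y) = X \<oplus> Y"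
    and "coproj2 C X Y \<in> Arr C" "Dom C (coproj2 C X Y) = Y" "Cod C (coproj2 C X Y) = X \<oplus> Y"
  using biprod_ob_closed proj1_closed proj2_closed coproj1_closed coproj2_closed assms
  by (simp_all add: hom_def)

lemma zero_arr_closed:
  assumes "X \<in> Ob C" "Y \<in> Ob C"
  shows "zero_arr C X Y \<in> hom C X Y"
  unfolding zero_arr_def
  using theI'[OF zero_ob_terminal[OF assms(1)]] theI'[OF zero_ob_initial[OF assms(2)]]
  by (rule compose_closed[rotated])

text \<open>Composing \<open>f\<close> with the unique arrow out of the zero object gives again an
  arrow out of the zero object, hence the unique one.\<close>

lemma zero_arr_right:
  assumes "f \<in> hom C Y Z" "X \<in> Ob C"
  shows "f \<cdot> zero_arr C X Y = zero_arr C X Z"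
proof -
  note [simp] = homD[OF assms(1)] assms(2)
  let ?u = "THE u. u \<in> hom C X (zero_ob C)"
  let ?i = "\<lambda>Y. THE i. i \<in> hom C (zero_ob C) Y"
  have u: "?u \<in> hom C X (zero_ob C)" using theI'[OF zero_ob_terminal[OF assms(2)]] .
  have i: "?i Y \<in> hom C (zero_ob C) Y" using theI'[OF zero_ob_initial[of Y]] assms by simp
  have "f \<cdot> ?i Y \<in> hom C (zero_ob C) Z" using assms(1) i by (rule compose_closed)
  then have "?i Z = f \<cdot> ?i Y" using zero_ob_initial[of Z] assms by (intro the1_equality) simp_all
  then show ?thesis using homD[OF u] homD[OF i] by (simp add: zero_arr_def)
qed

lemma zero_arr_left:
  assumes "f \<in> hom C X Y" "Z \<in> Ob C"
  shows "zero_arr C Y Z \<cdot> f = zero_arr C X Z"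
proof -
  note [simp] = homD[OF assms(1)] assms(2)
  let ?u = "\<lambda>X. THE u. u \<in> hom C X (zero_ob C)"
  let ?i = "THE i. i \<in> hom C (zero_ob C) Z"
  have u: "?u Y \<in> hom C Y (zero_ob C)" using theI'[OF zero_ob_terminal[of Y]] assms by simp
  have i: "?i \<in> hom C (zero_ob C) Z" using theI'[OF zero_ob_initial[OF assms(2)]] .
  have "?u Y \<cdot> f \<in> hom C X (zero_ob C)" using u assms(1) by (rule compose_closed)
  then have "?u X = ?u Y \<cdot> f" using zero_ob_terminal[of X] assms by (intro the1_equality) simp_all
  then show ?thesis using homD[OF u] homD[OF i] by (simp add: zero_arr_def)
qed

lemma pairing_simps:
  assumes "f \<in> hom C A X" "g \<in> hom C A Y"
  shows "pairing C f g \<in> hom C A (X \<oplus> Y)"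
    "proj1 C X Y \<cdot> pairing C f g = f" "proj2 C X Y \<cdot> pairing C f g = g"
  using theI'[OF biprod_product[OF _ _ assms]] homD[OF assms(1)] homD[OF assms(2)]
  by (simp_all add: pairing_def)

lemma pairing_eqI:
  assumes "h \<in> hom C A (X \<oplus> Y)" "X \<in> Ob C" "Y \<in> Ob C"
    "proj1 C X Y \<cdot> h = f" "proj2 C X Y \<cdot> h = g"
  shows "h = pairing C f g"
proof -
  note [simp] = homD[OF assms(1)] assms(2,3)
  have f: "f \<in> hom C A X" using assms(4) by (auto intro: homI)
  have g: "g \<in> hom C A Y" using assms(5) by (auto intro: homI)
  show ?thesis using biprod_product[OF assms(2,3) f g] pairing_simps[OF f g] assms by blast
qed

lemma codiagonal_simps:
  assumes "X \<in> Ob C"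
  shows "codiagonal C X \<in> hom C (X \<oplus> X) X"
    "codiagonal C X \<cdot> coproj1 C X X = \<one> X" "codiagonal C X \<cdot> coproj2 C X X = \<one> X"
  using theI'[OF biprod_coproduct[OF assms assms ident_closed ident_closed]] assms
  by (simp_all add: codiagonal_def copairing_def)

text \<open>The biproduct arrow of \<open>f\<close> and \<open>g\<close> after the diagonal has
  projections \<open>f\<close> and \<open>g\<close>, so it is their pairing. This shorter formula
  for the sum is the one used below.\<close>

lemma add_arr_eq:
  assumes "f \<in> hom C X Y" "g \<in> hom C X Y"
  shows "add_arr C f g = codiagonal C Y \<cdot> pairing C f g"
proof -
  note [simp] = homD[OF assms(1)] homD[OF assms(2)]
  have X: "X \<in> Ob C" "Y \<in> Ob C" using assms by simp_all
  have d: "diagonal C X \<in> hom C X (X \<oplus> X)" "proj1 C X X \<cdot> diagonal C X = \<one> X"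
    "proj2 C X X \<cdot> diagonal C X = \<one> X"
    unfolding diagonal_def by (rule pairing_simps; rule ident_closed[OF X(1)])+
  have fp: "f \<cdot> proj1 C X X \<in> hom C (X \<oplus> X) Y" "g \<cdot> proj2 C X X \<in> hom C (X \<oplus> X) Y"
    using assms X by (auto intro: homI)
  note b = pairing_simps[OF fp]
  note [simp] = homD[OF b(1)] homD[OF d(1)]
  have "pairing C (f \<cdot> proj1 C X X) (g \<cdot> proj2 C X X) \<cdot> diagonal C X = pairing C f g"
  proof (rule pairing_eqI)
    show "pairing C (f \<cdot> proj1 C X X) (g \<cdot> proj2 C X X) \<cdot> diagonal C X \<in> hom C X (Y \<oplus> Y)"
      using b(1) d(1) by (rule compose_closed)
    show "proj1 C Y Y \<cdot> pairing C (f \<cdot> proj1 C X X) (g \<cdot> proj2 C X X) \<cdot> diagonal C X = f"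
      by (subst assoc[symmetric]) (use b d X assms in simp_all)
    show "proj2 C Y Y \<cdot> pairing C (f \<cdot> proj1 C X X) (g \<cdot> proj2 C X X) \<cdot> diagonal C X = g"
      by (subst assoc[symmetric]) (use b d X assms in simp_all)
  qed (use X in simp_all)
  then show ?thesis by (simp add: add_arr_def biprod_arr_def)
qed

lemma add_arr_closed:
  assumes "f \<in> hom C X Y" "g \<in> hom C X Y"
  shows "add_arr C f g \<in> hom C X Y"
  using compose_closed[OF codiagonal_simps(1)[of Y] pairing_simps(1)[OF assms]] homD[OF assms(1)]
  by (simp add: add_arr_eq[OF assms])

lemma add_arr_compose_right:
  assumes "f \<in> hom C X Y" "g \<in> hom C X Y" "h \<in> hom C W X"
  shows "add_arr C f g \<cdot> h = add_arr C (f \<cdot> h) (g \<cdot> h)"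
proof -
  note [simp] = homD[OF assms(1)] homD[OF assms(2)] homD[OF assms(3)]
  have p: "pairing C f g \<in> hom C X (Y \<oplus> Y)" "proj1 C Y Y \<cdot> pairing C f g = f"
    "proj2 C Y Y \<cdot> pairing C f g = g" using pairing_simps[OF assms(1,2)] .
  note [simp] = homD[OF p(1)]
  have Y: "Y \<in> Ob C" using assms by simp
  have "pairing C f g \<cdot> h = pairing C (f \<cdot> h) (g \<cdot> h)"
  proof (rule pairing_eqI)
    show "pairing C f g \<cdot> h \<in> hom C W (Y \<oplus> Y)" using p(1) assms(3) by (rule compose_closed)
    show "proj1 C Y Y \<cdot> pairing C f g \<cdot> h = f \<cdot> h"
      by (subst assoc[symmetric]) (use p Y assms in simp_all)
    show "proj2 C Y Y \<cdot> pairing C f g \<cdot> h = g \<cdot> h"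
      by (subst assoc[symmetric]) (use p Y assms in simp_all)
  qed (use Y in simp_all)
  then show ?thesis
    using homD[OF codiagonal_simps(1)[OF Y]]
    by (simp add: add_arr_eq[OF assms(1,2)]
        add_arr_eq[OF compose_closed[OF assms(1,3)] compose_closed[OF assms(2,3)]])
qed

text \<open>Arrows out of \<open>Y \<oplus> Y\<close> are determined by their composites with the
  two coprojections, and for both sides these are \<open>h\<close>.\<close>

lemma codiagonal_natural:
  assumes "h \<in> hom C Y Z"
  shows "h \<cdot> codiagonal C Y
    = codiagonal C Z \<cdot> pairing C (h \<cdot> proj1 C Y Y) (h \<cdot> proj2 C Y Y)"
proof -
  note [simp] = homD[OF assms]
  have YZ: "Y \<in> Ob C" "Z \<in> Ob C" using assms by simp_all
  note cY = codiagonal_simps[OF YZ(1)] and cZ = codiagonal_simps[OF YZ(2)]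
  have hp: "h \<cdot> proj1 C Y Y \<in> hom C (Y \<oplus> Y) Z" "h \<cdot> proj2 C Y Y \<in> hom C (Y \<oplus> Y) Z"
    using assms YZ by (auto intro: homI)
  \<comment> \<open>This is the biproduct of \<open>h\<close> with itself, defined through
    projections; its behaviour on coprojections has to be derived.\<close>
  let ?b = "pairing C (h \<cdot> proj1 C Y Y) (h \<cdot> proj2 C Y Y)"
  note b = pairing_simps[OF hp]
  note [simp] = homD[OF b(1)] homD[OF cZ(1)] homD[OF cY(1)]
  note z = zero_arr_closed[OF YZ] zero_arr_right[OF assms YZ(1)] zero_arr_left[OF assms YZ(2)]
  \<comment> \<open>Both sides have projections \<open>h\<close> and zero. Here the relations
    between projections and coprojections enter, linking the product structure to the coproduct
    structure.\<close>
  have b1: "?b \<cdot> coproj1 C Y Y = coproj1 C Z Z \<cdot> h"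
  proof -
    have "?b \<cdot> coproj1 C Y Y = pairing C h (zero_arr C Y Z)"
    proof (rule pairing_eqI)
      show "?b \<cdot> coproj1 C Y Y \<in> hom C Y (Z \<oplus> Z)"
        using b YZ by (auto intro: homI)
      show "proj1 C Z Z \<cdot> ?b \<cdot> coproj1 C Y Y = h"
        by (subst assoc[symmetric]) (use b YZ assms proj1_coproj1 in simp_all)
      show "proj2 C Z Z \<cdot> ?b \<cdot> coproj1 C Y Y = zero_arr C Y Z"
        by (subst assoc[symmetric]) (use b YZ assms z proj2_coproj1 in simp_all)
    qed (use YZ in simp_all)
    also have "\<dots> = coproj1 C Z Z \<cdot> h"
    proof (rule pairing_eqI[symmetric])
      show "coproj1 C Z Z \<cdot> h \<in> hom C Y (Z \<oplus> Z)" using YZ assms by (auto intro: homI)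
      show "proj1 C Z Z \<cdot> coproj1 C Z Z \<cdot> h = h"
        by (subst assoc[symmetric]) (use YZ assms proj1_coproj1 in simp_all)
      show "proj2 C Z Z \<cdot> coproj1 C Z Z \<cdot> h = zero_arr C Y Z"
        by (subst assoc[symmetric]) (use YZ assms z proj2_coproj1 in simp_all)
    qed (use YZ in simp_all)
    finally show ?thesis .
  qed
  have b2: "?b \<cdot> coproj2 C Y Y = coproj2 C Z Z \<cdot> h"
  proof -
    have "?b \<cdot> coproj2 C Y Y = pairing C (zero_arr C Y Z) h"
    proof (rule pairing_eqI)
      show "?b \<cdot> coproj2 C Y Y \<in> hom C Y (Z \<oplus> Z)"
        using b YZ by (auto intro: homI)
      show "proj2 C Z Z \<cdot> ?b \<cdot> coproj2 C Y Y = h"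
        by (subst assoc[symmetric]) (use b YZ assms proj2_coproj2 in simp_all)
      show "proj1 C Z Z \<cdot> ?b \<cdot> coproj2 C Y Y = zero_arr C Y Z"
        by (subst assoc[symmetric]) (use b YZ assms z proj1_coproj2 in simp_all)
    qed (use YZ in simp_all)
    also have "\<dots> = coproj2 C Z Z \<cdot> h"
    proof (rule pairing_eqI[symmetric])
      show "coproj2 C Z Z \<cdot> h \<in> hom C Y (Z \<oplus> Z)" using YZ assms by (auto intro: homI)
      show "proj2 C Z Z \<cdot> coproj2 C Z Z \<cdot> h = h"
        by (subst assoc[symmetric]) (use YZ assms proj2_coproj2 in simp_all)
      show "proj1 C Z Z \<cdot> coproj2 C Z Z \<cdot> h = zero_arr C Y Z"
        by (subst assoc[symmetric]) (use YZ assms z proj1_coproj2 in simp_all)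
    qed (use YZ in simp_all)
    finally show ?thesis .
  qed
  have "(codiagonal C Z \<cdot> ?b) \<cdot> coproj1 C Y Y = h"
    using YZ cZ assoc[of "codiagonal C Z" "coproj1 C Z Z" h, symmetric]
    by (simp add: b1 del: assoc) (simp add: b1)
  moreover have "(codiagonal C Z \<cdot> ?b) \<cdot> coproj2 C Y Y = h"
    using YZ cZ assoc[of "codiagonal C Z" "coproj2 C Z Z" h, symmetric]
    by (simp add: b2 del: assoc) (simp add: b2)
  moreover have "codiagonal C Z \<cdot> ?b \<in> hom C (Y \<oplus> Y) Z"
    using cZ(1) b(1) by (rule compose_closed)
  moreover have "h \<cdot> codiagonal C Y \<in> hom C (Y \<oplus> Y) Z"
    using assms cY(1) by (rule compose_closed)
  moreover have "(h \<cdot> codiagonal C Y) \<cdot> coproj1 C Y Y = h" "(h \<cdot> codiagonal C Y) \<cdot> coproj2 C Y Y = h"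
    using cY YZ by simp_all
  ultimately show ?thesis
    using biprod_coproduct[OF YZ(1) YZ(1) assms assms] by blast
qed

text \<open>Unlike precomposition, which passes directly into the pairing, postcomposition must
  first cross the codiagonal by \<open>codiagonal_natural\<close>; the biproduct of \<open>h\<close>
  with itself then acts on the pairing componentwise.\<close>

lemma add_arr_compose_left:
  assumes "f \<in> hom C X Y" "g \<in> hom C X Y" "h \<in> hom C Y Z"
  shows "h \<cdot> add_arr C f g = add_arr C (h \<cdot> f) (h \<cdot> g)"
proof -
  note [simp] = homD[OF assms(1)] homD[OF assms(2)] homD[OF assms(3)]
  have YZ: "Y \<in> Ob C" "Z \<in> Ob C" using assms by simp_all
  note cY = codiagonal_simps[OF YZ(1)] and cZ = codiagonal_simps[OF YZ(2)]
  have p: "pairing C f g \<in> hom C X (Y \<oplus> Y)" "proj1 C Y Y \<cdot> pairing C f g = f"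
    "proj2 C Y Y \<cdot> pairing C f g = g" using pairing_simps[OF assms(1,2)] .
  have hp: "h \<cdot> proj1 C Y Y \<in> hom C (Y \<oplus> Y) Z" "h \<cdot> proj2 C Y Y \<in> hom C (Y \<oplus> Y) Z"
    using assms YZ by (auto intro: homI)
  let ?b = "pairing C (h \<cdot> proj1 C Y Y) (h \<cdot> proj2 C Y Y)"
  note b = pairing_simps[OF hp]
  note [simp] = homD[OF b(1)] homD[OF cZ(1)] homD[OF cY(1)] homD[OF p(1)]
  have eq: "?b \<cdot> pairing C f g = pairing C (h \<cdot> f) (h \<cdot> g)"
  proof (rule pairing_eqI)
    show "?b \<cdot> pairing C f g \<in> hom C X (Z \<oplus> Z)" using b(1) p(1) by (rule compose_closed)
    show "proj1 C Z Z \<cdot> ?b \<cdot> pairing C f g = h \<cdot> f"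
      by (subst assoc[symmetric]) (use p b YZ assms in simp_all)
    show "proj2 C Z Z \<cdot> ?b \<cdot> pairing C f g = h \<cdot> g"
      by (subst assoc[symmetric]) (use p b YZ assms in simp_all)
  qed (use YZ in simp_all)
  have "h \<cdot> add_arr C f g = (h \<cdot> codiagonal C Y) \<cdot> pairing C f g"
    using assms p cY by (simp add: add_arr_eq[OF assms(1,2)])
  also have "\<dots> = codiagonal C Z \<cdot> pairing C (h \<cdot> f) (h \<cdot> g)"
    using b p cZ by (simp add: codiagonal_natural[OF assms(3)] eq)
  finally show ?thesis
    by (simp add: add_arr_eq[OF compose_closed[OF assms(3,1)] compose_closed[OF assms(3,2)]])
qed

lemma scalar_mult_closed:
  assumes "s \<in> hom C \<I> \<I>" "f \<in> hom C X Y"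
  shows "scalar_mult C s f \<in> hom C X Y"
  using homD[OF assms(1)] homD[OF assms(2)] by (intro homI) (simp_all add: scalar_mult_def)

text \<open>Naturality moves \<open>g\<close> across \<open>\<r>\<close>, and interchange absorbs it
  into the left tensor factor, leaving the scalar in the right factor untouched.\<close>

lemma scalar_mult_compose_left:
  assumes "s \<in> hom C \<I> \<I>" "f \<in> hom C X Y" "g \<in> hom C Y Z"
  shows "g \<cdot> scalar_mult C s f = scalar_mult C s (g \<cdot> f)"
proof -
  note [simp] = homD[OF assms(1)] homD[OF assms(2)] homD[OF assms(3)]
  have "g \<cdot> scalar_mult C s f = (g \<cdot> \<r> Y) \<cdot> (f \<otimes> s) \<cdot> \<r>\<^sup>- X"
    using assms by (simp add: scalar_mult_def)
  also have "\<dots> = (\<r> Z \<cdot> (g \<otimes> \<one> \<I>)) \<cdot> (f \<otimes> s) \<cdot> \<r>\<^sup>- X"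
    by (simp only: right_unitor_natural[OF assms(3)])
  finally show ?thesis using assms by (simp add: scalar_mult_def interchange_assoc)
qed

lemma scalar_mult_compose_right:
  assumes "s \<in> hom C \<I> \<I>" "f \<in> hom C X Y" "g \<in> hom C W X"
  shows "scalar_mult C s f \<cdot> g = scalar_mult C s (f \<cdot> g)"
  using homD[OF assms(1)] homD[OF assms(2)] homD[OF assms(3)] right_unitor_inv_natural[of g]
  by (simp add: scalar_mult_def interchange_assoc)

end

section \<open>Commutants as star-subsemialgebras, and maximality\<close>

lemma commutant_antimono: "A \<subseteq> B \<Longrightarrow> commutant C X B \<subseteq> commutant C X A"
  by (auto simp: commutant_def)

text \<open>Closure under sums and scalars is bilinearity of composition; closure under the dagger
  is where \<open>B\<close> has to be closed under the dagger.\<close>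

lemma (in dagger_biproduct_category) commutant_star_subsemialgebra:
  assumes X: "X \<in> Ob C" and B: "B \<subseteq> hom C X X" and dag: "\<And>g. g \<in> B \<Longrightarrow> g\<^sup>\<dagger> \<in> B"
  shows "star_subsemialgebra C X (commutant C X B)"
  unfolding star_subsemialgebra_def subsemialgebra_def
proof (intro conjI ballI)
  let ?A = "commutant C X B"
  note z = zero_arr_closed[OF X X]
  show "?A \<subseteq> hom C X X" by (auto simp: commutant_def)
  show "zero_arr C X X \<in> ?A"
    using B z by (auto simp: commutant_def zero_arr_left[OF _ X] zero_arr_right[OF _ X])
  show "\<one> X \<in> ?A"
    using B X ident_closed ident_left ident_right by (auto simp: commutant_def subset_iff)
  fix f assume "f \<in> ?A"
  then have f: "f \<in> hom C X X" "\<And>h. h \<in> B \<Longrightarrow> f \<cdot> h = h \<cdot> f" by (auto simp: commutant_def)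
  note [simp] = homD[OF f(1)]
  show "f\<^sup>\<dagger> \<in> ?A"
    unfolding commutant_def
  proof (intro CollectI conjI ballI)
    show "f\<^sup>\<dagger> \<in> hom C X X" using f(1) by (rule dag_closed)
    fix g assume g: "g \<in> B"
    have gX: "g \<in> hom C X X" using g B by auto
    note [simp] = homD[OF gX]
    \<comment> \<open>\<open>f\<close> commutes with \<open>g\<^sup>\<dagger>\<close>, again a
      member of \<open>B\<close>; the dagger of that equation is the one wanted for
      \<open>g\<close>.\<close>
    have "(f \<cdot> g\<^sup>\<dagger>)\<^sup>\<dagger> = (g\<^sup>\<dagger> \<cdot> f)\<^sup>\<dagger>" using f(2)[OF dag[OF g]] by simp
    then show "f\<^sup>\<dagger> \<cdot> g = g \<cdot> f\<^sup>\<dagger>" using f(1) gX by (simp add: dag_comp dag_dag)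
  qed
  show "scalar_mult C s f \<in> ?A" if "s \<in> hom C \<I> \<I>" for s
    using that f B unfolding commutant_def
    by (auto simp: scalar_mult_closed scalar_mult_compose_left scalar_mult_compose_right subset_iff)
  fix g assume "g \<in> ?A"
  then have g: "g \<in> hom C X X" "\<And>h. h \<in> B \<Longrightarrow> g \<cdot> h = h \<cdot> g" by (auto simp: commutant_def)
  note [simp] = homD[OF g(1)]
  show "add_arr C f g \<in> ?A"
    using f g B unfolding commutant_def
    by (auto simp: add_arr_closed add_arr_compose_left add_arr_compose_right subset_iff)
  show "f \<cdot> g \<in> ?A"
    unfolding commutant_def
  proof (intro CollectI conjI ballI)
    show "f \<cdot> g \<in> hom C X X" using f(1) g(1) by (rule compose_closed)
    fix h assume h: "h \<in> B"
    then have hX: "h \<in> hom C X X" using B by auto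
    note [simp] = homD[OF hX]
    have "(f \<cdot> g) \<cdot> h = f \<cdot> h \<cdot> g" using f g h hX by simp
    also have "\<dots> = (f \<cdot> h) \<cdot> g" using f(1) g(1) hX by simp
    also have "\<dots> = (h \<cdot> f) \<cdot> g" using f(2)[OF h] by simp
    finally show "(f \<cdot> g) \<cdot> h = h \<cdot> f \<cdot> g" using f(1) g(1) hX by simp
  qed
qed

text \<open>A commutative set containing \<open>A\<close> commutes with \<open>A\<close>, so it lies
  in the commutant of \<open>A\<close>, which is \<open>A\<close>. Applying the fixed-point equation
  twice gives the double commutant condition.\<close>

lemma self_commutant_maximal:
  assumes "star_subsemialgebra C X A" "A = commutant C X A"
  shows "maximal_commutative_von_Neumann_semialgebra C X A"
proof -
  have "commutative_set C A" using assms(2) by (auto simp: commutative_set_def commutant_def)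
  moreover have "B \<subseteq> A" if "subsemialgebra C X B" "commutative_set C B" "A \<subseteq> B" for B
  proof -
    have "B \<subseteq> commutant C X A"
      using that by (auto simp: subsemialgebra_def commutative_set_def commutant_def)
    then show ?thesis using assms(2) by simp
  qed
  ultimately show ?thesis
    using assms unfolding maximal_commutative_von_Neumann_semialgebra_def
      commutative_von_Neumann_semialgebra_def by (metis psubset_eq subset_antisym)
qed

section \<open>Multiplication operators of an H*-algebra and their commutant\<close>

locale H_star = dagger_biproduct_category C
  for C :: "('o, 'm, 'r) dagger_biprod_cat_scheme" (structure) +
  fixes X :: 'o and \<mu> :: 'm
  assumes well_pointed: "monoidally_well_pointed C" and H_star: "H_star_algebra C X \<mu>"
begin

lemma X_closed [simp]: "X \<in> Ob C" and mult_closed: "\<mu> \<in> hom C (X \<boxtimes> X) X"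
  and mult_assoc: "\<mu> \<cdot> (\<mu> \<otimes> \<one> X) = \<mu> \<cdot> (\<one> X \<otimes> \<mu>) \<cdot> \<a> X X X"
  and mult_symmetry: "\<mu> \<cdot> \<s> X X = \<mu>"
  and mult_dag: "\<mu> \<cdot> \<mu>\<^sup>\<dagger> = \<one> X"
  and mult_by_dag_ex: "x \<in> hom C \<I> X
    \<Longrightarrow> \<exists>x'\<in>hom C X \<I>. mult_by C X \<mu> x = \<r> X \<cdot> (\<one> X \<otimes> x') \<cdot> \<mu>\<^sup>\<dagger>"
  using H_star by (simp_all add: H_star_algebra_def mult_by_def)

lemmas mult_simps [simp] = homD[OF mult_closed]

abbreviation R where "R \<equiv> mult_by C X \<mu>"
abbreviation RR where "RR \<equiv> mult_operators C X \<mu>"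

lemma mult_by_closed: "x \<in> hom C \<I> X \<Longrightarrow> R x \<in> hom C X X"
  using homD[of x] by (intro homI) (simp_all add: mult_by_def)

lemma mult_operators_subset: "RR \<subseteq> hom C X X"
  using mult_by_closed by (auto simp: mult_operators_def)

text \<open>The dagger of the equation in axiom (H) exhibits the adjoint as right multiplication by
  the point \<open>x'\<^sup>\<dagger>\<close>. Commutativity of \<open>\<mu>\<close> turns this into
  left multiplication, so \<open>x'\<^sup>\<dagger>\<close> is the witness.\<close>

lemma mult_by_dag:
  assumes "x \<in> hom C \<I> X"
  shows "\<exists>y\<in>hom C \<I> X. (R x)\<^sup>\<dagger> = R y"
proof -
  obtain x' where x': "x' \<in> hom C X \<I>" "R x = \<r> X \<cdot> (\<one> X \<otimes> x') \<cdot> \<mu>\<^sup>\<dagger>"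
    using mult_by_dag_ex[OF assms] by auto
  have y: "x'\<^sup>\<dagger> \<in> hom C \<I> X" using x'(1) by (rule dag_closed)
  note [simp] = homD[OF x'(1)]
  have "(\<r> X)\<^sup>\<dagger> = \<r>\<^sup>- X" using right_unitor_unitary[of X] by (simp add: unitary_def)
  then have "(R x)\<^sup>\<dagger> = \<mu> \<cdot> (\<one> X \<otimes> x'\<^sup>\<dagger>) \<cdot> \<r>\<^sup>- X"
    using x' by (simp add: dag_comp dag_dag dag_tensor dag_ident)
  also have "\<dots> = (\<mu> \<cdot> \<s> X X) \<cdot> (\<one> X \<otimes> x'\<^sup>\<dagger>) \<cdot> \<r>\<^sup>- X"
    by (simp only: mult_symmetry)
  also have "\<dots> = \<mu> \<cdot> (\<s> X X \<cdot> (\<one> X \<otimes> x'\<^sup>\<dagger>)) \<cdot> \<r>\<^sup>- X"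
    using y by simp
  also have "\<dots> = \<mu> \<cdot> ((x'\<^sup>\<dagger> \<otimes> \<one> X) \<cdot> \<s> X \<I>) \<cdot> \<r>\<^sup>- X"
    using y by (subst symmetry_natural[of _ X _ _ \<I>]) (auto intro: ident_closed)
  also have "\<dots> = R (x'\<^sup>\<dagger>)"
    using y by (simp add: mult_by_def symmetry_right_unitor_inv)
  finally show ?thesis using y by blast
qed

lemma mult_operators_dag: "g \<in> RR \<Longrightarrow> g\<^sup>\<dagger> \<in> RR"
  using mult_by_dag by (fastforce simp: mult_operators_def)

text \<open>Pushing both inverse unitors to the right collects the two multiplications at the left,
  in the shape to which associativity of \<open>\<mu>\<close> applies.\<close>

lemma mult_by_mult_by:
  assumes x: "x \<in> hom C \<I> X" and y: "y \<in> hom C \<I> X"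
  shows "R x \<cdot> R y = \<mu> \<cdot> (\<one> X \<otimes> \<mu>) \<cdot> (x \<otimes> (y \<otimes> \<one> X)) \<cdot> (\<one> \<I> \<otimes> \<l>\<^sup>- X) \<cdot> \<l>\<^sup>- X"
proof -
  note [simp] = homD[OF x] homD[OF y]
  let ?h = "\<mu> \<cdot> (y \<otimes> \<one> X) \<cdot> \<l>\<^sup>- X"
  \<comment> \<open>The object \<open>X\<close> is written as \<open>Cod C ?h\<close> so that
    \<open>left_unitor_inv_natural\<close> matches.\<close>
  have "R x \<cdot> R y = \<mu> \<cdot> (x \<otimes> \<one> X) \<cdot> (\<l>\<^sup>- (Cod C ?h) \<cdot> ?h)"
    using x y by (simp add: mult_by_def)
  also have "\<dots> = \<mu> \<cdot> (x \<otimes> \<one> X) \<cdot> (\<one> \<I> \<otimes> ?h) \<cdot> \<l>\<^sup>- X"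
    using y by (subst left_unitor_inv_natural) simp_all
  finally show ?thesis using x y by (simp add: interchange_assoc)
qed

text \<open>By associativity \<open>R x \<cdot> R y\<close> is multiplication by the product point,
  so it depends on \<open>x\<close> and \<open>y\<close> only through
  \<open>\<mu> \<cdot> (x \<otimes> y)\<close>, which is symmetric in them.\<close>

lemma mult_by_commute:
  assumes x: "x \<in> hom C \<I> X" and y: "y \<in> hom C \<I> X"
  shows "R x \<cdot> R y = R y \<cdot> R x"
proof -
  note [simp] = homD[OF x] homD[OF y]
  have key: "R x \<cdot> R y = \<mu> \<cdot> ((\<mu> \<cdot> (x \<otimes> y)) \<otimes> \<one> X) \<cdot> (\<r>\<^sup>- \<I> \<otimes> \<one> X) \<cdot> \<l>\<^sup>- X"
    if x: "x \<in> hom C \<I> X" and y: "y \<in> hom C \<I> X" for x y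
  proof -
    note [simp] = homD[OF x] homD[OF y]
    \<comment> \<open>The triangle identity with its unitors inverted. Read backwards, it creates
      the associator that naturality then carries over to \<open>\<mu>\<close>.\<close>
    have tri: "\<a> \<I> \<I> X \<cdot> (\<r>\<^sup>- \<I> \<otimes> \<one> X) = \<one> \<I> \<otimes> \<l>\<^sup>- X"
    proof -
      have "\<a> \<I> \<I> X \<cdot> (\<r>\<^sup>- \<I> \<otimes> \<one> X)
          = ((\<one> \<I> \<otimes> \<l>\<^sup>- X) \<cdot> (\<one> \<I> \<otimes> \<l> X)) \<cdot> \<a> \<I> \<I> X \<cdot> (\<r>\<^sup>- \<I> \<otimes> \<one> X)"
        by (subst interchange) simp_all
      also have "\<dots> = (\<one> \<I> \<otimes> \<l>\<^sup>- X) \<cdot> ((\<one> \<I> \<otimes> \<l> X) \<cdot> \<a> \<I> \<I> X) \<cdot> (\<r>\<^sup>- \<I> \<otimes> \<one> X)"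
        by simp
      also have "\<dots> = (\<one> \<I> \<otimes> \<l>\<^sup>- X) \<cdot> (\<r> \<I> \<otimes> \<one> X) \<cdot> (\<r>\<^sup>- \<I> \<otimes> \<one> X)"
        by (simp only: triangle unit_ob_closed X_closed)
      finally show ?thesis by (simp add: interchange)
    qed
    have "R x \<cdot> R y = \<mu> \<cdot> (\<one> X \<otimes> \<mu>) \<cdot> (x \<otimes> (y \<otimes> \<one> X)) \<cdot> (\<a> \<I> \<I> X \<cdot> (\<r>\<^sup>- \<I> \<otimes> \<one> X)) \<cdot> \<l>\<^sup>- X"
      unfolding tri by (rule mult_by_mult_by[OF x y])
    also have "\<dots> = \<mu> \<cdot> (\<one> X \<otimes> \<mu>) \<cdot> ((x \<otimes> (y \<otimes> \<one> X)) \<cdot> \<a> \<I> \<I> X) \<cdot> (\<r>\<^sup>- \<I> \<otimes> \<one> X) \<cdot> \<l>\<^sup>- X"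
      using x y by simp
    also have "\<dots> = \<mu> \<cdot> (\<one> X \<otimes> \<mu>) \<cdot> (\<a> X X X \<cdot> ((x \<otimes> y) \<otimes> \<one> X)) \<cdot> (\<r>\<^sup>- \<I> \<otimes> \<one> X) \<cdot> \<l>\<^sup>- X"
      by (simp only: associator_natural[OF x y ident_closed[OF X_closed]])
    also have "\<dots> = (\<mu> \<cdot> (\<one> X \<otimes> \<mu>) \<cdot> \<a> X X X) \<cdot> ((x \<otimes> y) \<otimes> \<one> X) \<cdot> (\<r>\<^sup>- \<I> \<otimes> \<one> X) \<cdot> \<l>\<^sup>- X"
      using x y by simp
    also have "\<dots> = (\<mu> \<cdot> (\<mu> \<otimes> \<one> X)) \<cdot> ((x \<otimes> y) \<otimes> \<one> X) \<cdot> (\<r>\<^sup>- \<I> \<otimes> \<one> X) \<cdot> \<l>\<^sup>- X"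
      by (simp only: mult_assoc)
    finally show ?thesis by (simp add: interchange_assoc)
  qed
  \<comment> \<open>Naturality carries the symmetry past the two points, where it becomes
    \<open>\<s> \<I> \<I>\<close>, an identity.\<close>
  have "\<mu> \<cdot> (x \<otimes> y) = (\<mu> \<cdot> \<s> X X) \<cdot> (x \<otimes> y)" by (simp only: mult_symmetry)
  also have "\<dots> = \<mu> \<cdot> (\<s> X X \<cdot> (x \<otimes> y))" using x y by simp
  also have "\<dots> = \<mu> \<cdot> (y \<otimes> x)"
    using x y by (simp add: symmetry_natural[OF x y] symmetry_unit_unit)
  finally show ?thesis by (simp only: key[OF x y] key[OF y x])
qed

lemma mult_operators_subset_commutant: "RR \<subseteq> commutant C X RR"
  using mult_operators_subset by (auto simp: commutant_def mult_operators_def mult_by_commute)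

text \<open>Links well-pointedness, which tests arrows on tensors of points, to the operators
  \<open>R x\<close>, in terms of which the commutant is defined.\<close>

lemma mult_tensor_points:
  assumes "x \<in> hom C \<I> X" "y \<in> hom C \<I> X"
  shows "\<mu> \<cdot> (x \<otimes> y) = R x \<cdot> y \<cdot> \<l> \<I>"
proof -
  note [simp] = homD[OF assms(1)] homD[OF assms(2)]
  have "R x \<cdot> y \<cdot> \<l> \<I> = \<mu> \<cdot> (x \<otimes> \<one> X) \<cdot> (\<l>\<^sup>- (Cod C y) \<cdot> y) \<cdot> \<l> \<I>"
    using assms by (simp add: mult_by_def)
  also have "\<dots> = \<mu> \<cdot> (x \<otimes> \<one> X) \<cdot> ((\<one> \<I> \<otimes> y) \<cdot> \<l>\<^sup>- \<I>) \<cdot> \<l> \<I>"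
    using assms by (subst left_unitor_inv_natural) simp_all
  also have "\<dots> = \<mu> \<cdot> (x \<otimes> y)" using assms by (simp add: interchange)
  finally show ?thesis by simp
qed

text \<open>By well-pointedness it suffices to compare values on \<open>x \<otimes> y\<close>. There
  \<open>\<mu>\<close> acts as \<open>R x\<close> on \<open>y\<close>, and the equation is the
  assumption that \<open>f\<close> commutes with \<open>R x\<close>.\<close>

lemma commutant_mult_right:
  assumes "f \<in> commutant C X RR"
  shows "f \<cdot> \<mu> = \<mu> \<cdot> (\<one> X \<otimes> f)"
proof -
  have f: "f \<in> hom C X X" and comm: "\<And>x. x \<in> hom C \<I> X \<Longrightarrow> f \<cdot> R x = R x \<cdot> f"
    using assms by (auto simp: commutant_def mult_operators_def)
  note [simp] = homD[OF f]
  have "(f \<cdot> \<mu>) \<cdot> (x \<otimes> y) = (\<mu> \<cdot> (\<one> X \<otimes> f)) \<cdot> (x \<otimes> y)"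
    if x: "x \<in> hom C \<I> X" and y: "y \<in> hom C \<I> X" for x y
  proof -
    note r = mult_by_closed[OF x]
    note [simp] = homD[OF r] homD[OF x] homD[OF y]
    have "(f \<cdot> \<mu>) \<cdot> (x \<otimes> y) = (f \<cdot> R x) \<cdot> y \<cdot> \<l> \<I>"
      using f r x y by (simp add: mult_tensor_points)
    also have "\<dots> = R x \<cdot> (f \<cdot> y) \<cdot> \<l> \<I>"
      using f r x y by (simp add: comm)
    \<comment> \<open>\<open>mult_tensor_points\<close> read backwards, at the point
      \<open>f \<cdot> y\<close>.\<close>
    also have "\<dots> = \<mu> \<cdot> (x \<otimes> (f \<cdot> y))"
      using f x y by (subst mult_tensor_points) (auto intro: compose_closed)
    finally show ?thesis using f x y by (simp add: interchange)
  qed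
  moreover have "f \<cdot> \<mu> \<in> hom C (X \<boxtimes> X) X" "\<mu> \<cdot> (\<one> X \<otimes> f) \<in> hom C (X \<boxtimes> X) X"
    using f by (auto intro!: homI)
  ultimately show ?thesis
    using well_pointed X_closed unfolding monoidally_well_pointed_def by blast
qed

text \<open>Linearity in the second factor is carried to the first by conjugating with the symmetry,
  which \<open>\<mu>\<close> absorbs.\<close>

lemma commutant_mult_left:
  assumes "f \<in> commutant C X RR"
  shows "f \<cdot> \<mu> = \<mu> \<cdot> (f \<otimes> \<one> X)"
proof -
  have f: "f \<in> hom C X X" using assms by (auto simp: commutant_def)
  note [simp] = homD[OF f]
  have "f \<cdot> \<mu> = (f \<cdot> \<mu>) \<cdot> \<s> X X"
    using f by (simp add: mult_symmetry)
  also have "\<dots> = \<mu> \<cdot> ((\<one> X \<otimes> f) \<cdot> \<s> X X)"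
    using f by (simp add: commutant_mult_right[OF assms])
  also have "\<dots> = \<mu> \<cdot> (\<s> X X \<cdot> (f \<otimes> \<one> X))"
    by (simp only: symmetry_natural[OF f ident_closed[OF X_closed]])
  also have "\<dots> = (\<mu> \<cdot> \<s> X X) \<cdot> (f \<otimes> \<one> X)" using f by simp
  finally show ?thesis by (simp only: mult_symmetry)
qed

text \<open>\<open>f\<close> acts on the left factor and \<open>g\<close> on the right one. These
  actions are independent, so \<open>\<mu> \<cdot> (f \<otimes> g)\<close> equals both
  \<open>f \<cdot> g \<cdot> \<mu>\<close> and \<open>g \<cdot> f \<cdot> \<mu>\<close>.\<close>

lemma commutant_commutative: "commutative_set C (commutant C X RR)"
  unfolding commutative_set_def
proof (intro ballI)
  fix f g assume fA: "f \<in> commutant C X RR" and gA: "g \<in> commutant C X RR"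
  have f: "f \<in> hom C X X" and g: "g \<in> hom C X X" using fA gA by (auto simp: commutant_def)
  note [simp] = homD[OF f] homD[OF g]
  have "f \<cdot> g \<cdot> \<mu> = (f \<cdot> \<mu>) \<cdot> (\<one> X \<otimes> g)"
    using f g by (simp add: commutant_mult_right[OF gA])
  also have "\<dots> = \<mu> \<cdot> (f \<otimes> g)"
    using f g by (simp add: commutant_mult_left[OF fA] interchange)
  also have "\<dots> = (g \<cdot> \<mu>) \<cdot> (f \<otimes> \<one> X)"
    using f g by (simp add: commutant_mult_right[OF gA] interchange)
  also have "\<dots> = g \<cdot> f \<cdot> \<mu>"
    using f g by (simp add: commutant_mult_left[OF fA])
  \<comment> \<open>By axiom (S), \<open>\<mu>\<^sup>\<dagger>\<close> is a right inverse of
    \<open>\<mu>\<close>, so \<open>\<mu>\<close> can be cancelled.\<close>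
  finally have "((f \<cdot> g) \<cdot> \<mu>) \<cdot> \<mu>\<^sup>\<dagger> = ((g \<cdot> f) \<cdot> \<mu>) \<cdot> \<mu>\<^sup>\<dagger>" using f g by simp
  then show "f \<cdot> g = g \<cdot> f" using f g by (simp add: mult_dag)
qed

text \<open>One inclusion is the commutativity just shown; the other reverses the inclusion of the
  multiplication operators in their commutant.\<close>

lemma commutant_self_commutant: "commutant C X RR = commutant C X (commutant C X RR)"
proof
  show "commutant C X (commutant C X RR) \<subseteq> commutant C X RR"
    by (rule commutant_antimono) (rule mult_operators_subset_commutant)
  show "commutant C X RR \<subseteq> commutant C X (commutant C X RR)"
    using commutant_commutative by (auto simp: commutative_set_def commutant_def)
qed

lemma commutant_maximal:
  "maximal_commutative_von_Neumann_semialgebra C X (commutant C X RR)"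
  by (rule self_commutant_maximal[OF commutant_star_subsemialgebra commutant_self_commutant])
    (use mult_operators_subset mult_operators_dag in auto)

text \<open>Multiplication by the unit point \<open>e\<close> is the identity, so linearity of
  \<open>f\<close> in the first factor turns \<open>f = f \<cdot> R e\<close> into
  \<open>R (f \<cdot> e)\<close>.\<close>

lemma unital_mult_operators_eq:
  assumes "unit_axiom C X \<mu>"
  shows "RR = commutant C X RR"
proof
  show "commutant C X RR \<subseteq> RR"
  proof
    fix f assume fA: "f \<in> commutant C X RR"
    have f: "f \<in> hom C X X" using fA by (auto simp: commutant_def)
    obtain e where e: "e \<in> hom C \<I> X" "R e = \<one> X"
      using assms by (auto simp: unit_axiom_def mult_by_def)
    note [simp] = homD[OF f] homD[OF e(1)]
    have "f = f \<cdot> R e" using f e by simp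
    also have "\<dots> = (f \<cdot> \<mu>) \<cdot> (e \<otimes> \<one> X) \<cdot> \<l>\<^sup>- X" using f e(1) by (simp add: mult_by_def)
    also have "\<dots> = R (f \<cdot> e)"
      using f e(1) by (simp add: mult_by_def commutant_mult_left[OF fA] interchange_assoc)
    finally show "f \<in> RR" using compose_closed[OF f e(1)] by (auto simp: mult_operators_def)
  qed
qed (rule mult_operators_subset_commutant)

end

theorem theorem17:
  fixes C :: "('o, 'm, 'r) dagger_biprod_cat_scheme" and X :: 'o and \<mu> :: 'm
  assumes "dagger_biproduct_category C"
    and "monoidally_well_pointed C"
    and "H_star_algebra C X \<mu>"
  shows "maximal_commutative_von_Neumann_semialgebra C X (commutant C X (mult_operators C X \<mu>)) \<and>
    (unit_axiom C X \<mu> \<longrightarrow> mult_operators C X \<mu> = commutant C X (mult_operators C X \<mu>))"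
proof -
  interpret H_star C X \<mu>
    using assms by (intro H_star.intro H_star_axioms.intro)
  show ?thesis using commutant_maximal unital_mult_operators_eq by blast
qed

end
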